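(* Let $\delta\in\mathbb{C}$. Every metabelian Lie algebra over $\mathbb{C}$ can be embedded into a suitable $\delta$-Novikov algebra with respect to the commutator product; that is, for every metabelian Lie algebra $L$ there exist a $\delta$-Novikov algebra $(N,\cdot)$ and an injective linear map $\iota:L\to N$ such that $\iota([a,b])=\iota(a)\cdot\iota(b)-\iota(b)\cdot\iota(a)$ for all $a,b\in L$.
   Context: A (left) $\delta$-Novikov algebra is a (not necessarily associative) algebra satisfying, for all $x,y,z$, $\delta(xy)z-x(yz)=\delta(yx)z-y(xz)$ and $(xy)z=(xz)y$. A Lie algebra is metabelian if $[[x,y],[z,t]]=0$ for all its elements. *)

theory Defs
  imports Complex_Main "HOL-Library.Product_Plus" "HOL-Library.Function_Algebras"
begin

locale nonassoc_algebra = vector_space scale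
  for scale :: "'k::field \<Rightarrow> 'a::ab_group_add \<Rightarrow> 'a" +
  fixes mult :: "'a \<Rightarrow> 'a \<Rightarrow> 'a"
  assumes linear_right: "Vector_Spaces.linear scale scale (\<lambda>y. mult x y)"
    and linear_left: "Vector_Spaces.linear scale scale (\<lambda>x. mult x y)"

locale lie_algebra = nonassoc_algebra scale bracket
  for scale :: "'k::field \<Rightarrow> 'a::ab_group_add \<Rightarrow> 'a" and bracket :: "'a \<Rightarrow> 'a \<Rightarrow> 'a" +
  assumes alternating: "bracket x x = 0"
    and jacobi: "bracket x (bracket y z) + bracket y (bracket z x) + bracket z (bracket x y) = 0"

locale metabelian_lie_algebra = lie_algebra scale bracket
  for scale :: "'k::field \<Rightarrow> 'a::ab_group_add \<Rightarrow> 'a" and bracket :: "'a \<Rightarrow> 'a \<Rightarrow> 'a" +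
  assumes metabelian: "bracket (bracket x y) (bracket z t) = 0"

locale delta_novikov_algebra = nonassoc_algebra scale mult
  for \<delta> :: "'k::field" and scale :: "'k \<Rightarrow> 'a::ab_group_add \<Rightarrow> 'a" and mult :: "'a \<Rightarrow> 'a \<Rightarrow> 'a" +
  assumes delta_left_symmetric:
      "scale \<delta> (mult (mult x y) z) - mult x (mult y z)
        = scale \<delta> (mult (mult y x) z) - mult y (mult x z)"
    and right_commutative: "mult (mult x y) z = mult (mult x z) y"

text \<open>
  HOL cannot quantify existentially over types, so an algebra that is asserted to exist for a
  given algebra on \<^typ>\<open>'a\<close> needs a type depending on \<^typ>\<open>'a\<close> only. The type below, with
  componentwise and pointwise addition, entails no loss of generality for embeddings over the
  complex numbers: if a space L on \<^typ>\<open>'a\<close> embeds into some algebra N, then the subalgebra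
  generated by its image has dimension at most the cardinality of L (or is 0), which is at most
  the dimension of the type below, and its product extends to the whole type by letting a linear
  complement multiply to 0. Multilinear identities such as those of a delta-Novikov algebra
  survive this extension.
\<close>
type_synonym 'a envelope = "'a \<times> ('a list \<Rightarrow> 'a)"

end

theory Submission
  imports Defs
begin

text \<open>
  Let \<open>L\<close> be a metabelian Lie algebra and \<open>M = [L,L]\<close>. As \<open>M\<close> is abelian and the operators
  \<open>ad x\<close> commute on \<open>M\<close>, \<open>M\<close> is a module over the symmetric algebra \<open>S\<close> of \<open>L\<close>, on which the
  elements of \<open>M\<close> act as \<open>0\<close>, and \<open>L\<close> is an extension of the abelian Lie algebra \<open>L/M\<close> by it.
  The class of such an extension dies as soon as \<open>M\<close> is enlarged to a coinduced module, and this is what makes \<open>[a,b]\<close> a commutator.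

  The coinduced module used here is \<open>Hom(S,L)\<close>, seen as the space \<open>W\<close> of symmetric multilinear
  functions from words over \<open>L\<close> to \<open>L\<close>; a letter \<open>x\<close> acts by the shift \<open>(x\<cdot>\<phi>)(w) = \<phi>(x # w)\<close>,
  and shifts commute on \<open>W\<close>. The product \<open>(x,\<phi>)(y,\<psi>) = (0, x\<cdot>\<psi>)\<close> then satisfies \<open>(uv)t = 0\<close> and \<open>u(vt) = v(ut)\<close>. In
  the \<open>\<delta>\<close>-Novikov identities every term carrying \<open>\<delta>\<close> has the form \<open>(uv)t\<close>, so a single product
  serves all \<open>\<delta>\<close> at once (\<open>delta_novikov_shift_mult\<close>).

  It remains to choose \<open>\<iota>(x) = (p x, g x)\<close>, where \<open>p\<close> is a linear projection with kernel \<open>M\<close>.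
  Since products have first component \<open>0\<close>, \<open>\<iota>\<close> turns brackets into commutators exactly when
  \[ (p x)\cdot g(y) - (p y)\cdot g(x) = g([x,y]). \]
  On \<open>M\<close>, let \<open>g\<close> be the embedding \<open>m \<mapsto> (w \<mapsto> ad w m)\<close> into \<open>W\<close>, a module homomorphism. On the
  complement \<open>p(L)\<close> of \<open>M\<close>, the equation asks \<open>g\<close> to write the cocycle \<open>[x,y]\<close> as a coboundary, and
  the Poincare homotopy for the Koszul complex does so. Both prescriptions are met by one formula,
  whose initial term \<open>ad w (y - p y)\<close> vanishes on the complement and normalises \<open>g\<close> on \<open>M\<close>:
  \[ g(y)(w) = \frac{1}{|w|+1}\Bigl(ad_w (y - p y) + \sum_i ad_{w \setminus w_i} [w_i, y]\Bigr). \]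
  The coboundary equation is \<open>homotopy_cocycle\<close> combined with \<open>homotopy_on_derived\<close>. The map
  \<open>\<iota>\<close> is injective because \<open>p x + g x [] = x\<close>.
\<close>

lemma linear_projection_exists:
  assumes "vector_space scale" and "module.subspace scale S"
  obtains P where "Vector_Spaces.linear scale scale P" "\<And>x. P x \<in> S" "\<And>x. x \<in> S \<Longrightarrow> P x = x"
proof -
  interpret vector_space scale by (rule assms)
  interpret vector_space_pair scale scale by unfold_locales
  from linear_exists_left_inverse_on[OF linear_id assms(2) inj_on_id]
  show thesis using that by (auto simp: id_def)
qed

section \<open>Symmetric multilinear functions on words\<close>

text \<open>A locale of its own, because the real vector spaces already interpret \<^locale>\<open>vector_space\<close>
  globally, which would attach the constants below to real scalars.\<close>
locale word_functions = vector_space scale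
  for scale :: "'k::field \<Rightarrow> 'a::ab_group_add \<Rightarrow> 'a"
begin

definition sym_multilinear :: "('a list \<Rightarrow> 'a) set" where
  "sym_multilinear = {\<phi>.
     (\<forall>u x y w. \<phi> (u @ x # y # w) = \<phi> (u @ y # x # w)) \<and>
     (\<forall>u x y w. \<phi> (u @ (x + y) # w) = \<phi> (u @ x # w) + \<phi> (u @ y # w)) \<and>
     (\<forall>u c x w. \<phi> (u @ scale c x # w) = scale c (\<phi> (u @ x # w)))}"

definition scale_fun :: "'k \<Rightarrow> ('a list \<Rightarrow> 'a) \<Rightarrow> 'a list \<Rightarrow> 'a" where
  "scale_fun c \<phi> = (\<lambda>w. scale c (\<phi> w))"

definition scale_env :: "'k \<Rightarrow> 'a envelope \<Rightarrow> 'a envelope" where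
  "scale_env c v = (scale c (fst v), scale_fun c (snd v))"

lemma scale_fun_apply: "scale_fun c \<phi> w = scale c (\<phi> w)"
  by (simp add: scale_fun_def)

lemma vector_space_scale_fun: "vector_space scale_fun"
  by unfold_locales (auto simp: scale_fun_def fun_eq_iff scale_left_distrib scale_right_distrib)

lemma vector_space_scale_env: "vector_space scale_env"
proof -
  interpret F: vector_space scale_fun by (rule vector_space_scale_fun)
  show ?thesis
    by unfold_locales (auto simp: scale_env_def prod_eq_iff scale_left_distrib
        scale_right_distrib F.scale_left_distrib F.scale_right_distrib)
qed

lemma subspace_sym_multilinear: "module.subspace scale_fun sym_multilinear"
proof -
  interpret F: vector_space scale_fun by (rule vector_space_scale_fun)
  show ?thesis
    by (rule F.subspaceI)
       (auto simp: sym_multilinear_def scale_fun_def scale_right_distrib mult.commute)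
qed

lemma sym_multilinearD:
  assumes "\<phi> \<in> sym_multilinear"
  shows "\<phi> (u @ x # y # w) = \<phi> (u @ y # x # w)"
    and "\<phi> (u @ (x + y) # w) = \<phi> (u @ x # w) + \<phi> (u @ y # w)"
    and "\<phi> (u @ scale c x # w) = scale c (\<phi> (u @ x # w))"
  using assms unfolding sym_multilinear_def by blast+

lemmas sym_multilinear_swap = sym_multilinearD(1)[where u = "[]", unfolded append_Nil]
lemmas sym_multilinear_add = sym_multilinearD(2)[where u = "[]", unfolded append_Nil]
lemmas sym_multilinear_scale = sym_multilinearD(3)[where u = "[]", unfolded append_Nil]

lemma sym_multilinear_Cons:
  assumes "\<phi> \<in> sym_multilinear"
  shows "(\<lambda>w. \<phi> (x # w)) \<in> sym_multilinear"
  unfolding sym_multilinear_def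
  using sym_multilinearD[OF assms, of "x # u" for u, unfolded append_Cons] by blast

lemma sym_multilinear_zero: "\<phi> \<in> sym_multilinear \<Longrightarrow> \<phi> (0 # w) = 0"
  using sym_multilinear_scale[of \<phi> 0 0 w] by simp

section \<open>The shift product\<close>

text \<open>The operator \<open>P\<close> is meant to project onto the symmetric multilinear functions: it makes the
  product total on \<^typ>\<open>'a envelope\<close>, by letting a complement of these functions multiply to \<open>0\<close>
  from the right.\<close>
definition shift_mult ::
    "(('a list \<Rightarrow> 'a) \<Rightarrow> 'a list \<Rightarrow> 'a) \<Rightarrow> 'a envelope \<Rightarrow> 'a envelope \<Rightarrow> 'a envelope" where
  "shift_mult P u v = (0, \<lambda>w. P (snd v) (fst u # w))"

text \<open>A product has first component \<open>0\<close>, so it annihilates everything from the left; left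
  multiplications commute because a symmetric function ignores the order of two letters.\<close>
lemma delta_novikov_shift_mult:
  assumes P: "Vector_Spaces.linear scale_fun scale_fun P"
    and range_P: "\<And>\<phi>. P \<phi> \<in> sym_multilinear"
    and P_id: "\<And>\<phi>. \<phi> \<in> sym_multilinear \<Longrightarrow> P \<phi> = \<phi>"
  shows "delta_novikov_algebra \<delta> scale_env (shift_mult P)"
proof -
  interpret E: vector_space scale_env by (rule vector_space_scale_env)
  interpret P: Vector_Spaces.linear scale_fun scale_fun P by (rule P)
  have P_add: "P (\<phi> + \<psi>) w = P \<phi> w + P \<psi> w"
    and P_scale: "P (scale_fun c \<phi>) w = scale c (P \<phi> w)" for \<phi> \<psi> c w
    by (simp_all add: P.add P.scale scale_fun_apply)
  have right: "Vector_Spaces.linear scale_env scale_env (\<lambda>v. shift_mult P u v)" for u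
    by (auto simp: Vector_Spaces.linear_iff vector_space_scale_env shift_mult_def scale_env_def
        fun_eq_iff P_add P_scale scale_fun_apply)
  have left: "Vector_Spaces.linear scale_env scale_env (\<lambda>u. shift_mult P u v)" for v
    by (auto simp: Vector_Spaces.linear_iff vector_space_scale_env shift_mult_def scale_env_def
        scale_fun_def fun_eq_iff sym_multilinear_add[OF range_P]
        sym_multilinear_scale[OF range_P])
  have left_nil: "shift_mult P (shift_mult P u v) t = 0" for u v t
    by (simp add: shift_mult_def sym_multilinear_zero[OF range_P] zero_prod_def zero_fun_def)
  have left_comm: "shift_mult P u (shift_mult P v t) = shift_mult P v (shift_mult P u t)" for u v t
    by (simp add: shift_mult_def P_id[OF sym_multilinear_Cons[OF range_P]]
        sym_multilinear_swap[OF range_P, of _ "fst u" "fst v"])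
  show ?thesis
    by (intro delta_novikov_algebra.intro nonassoc_algebra.intro nonassoc_algebra_axioms.intro
        delta_novikov_algebra_axioms.intro E.vector_space_axioms right left)
      (simp_all add: left_nil left_comm)
qed

end

section \<open>The derived algebra as a module and the Poincare homotopy\<close>

text \<open>The map \<open>q\<close> is a linear projection onto the derived algebra, so \<open>x - q x\<close> is a representative
  of the class of \<open>x\<close> modulo the derived algebra that depends linearly on \<open>x\<close>.\<close>
locale metabelian_split = metabelian_lie_algebra scale bracket + word_functions scale
  for scale :: "'k::field_char_0 \<Rightarrow> 'a::ab_group_add \<Rightarrow> 'a" and bracket :: "'a \<Rightarrow> 'a \<Rightarrow> 'a" +
  fixes q :: "'a \<Rightarrow> 'a"
  assumes q_linear: "Vector_Spaces.linear scale scale q"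
    and q_derived: "q x \<in> span (range (case_prod bracket))"
    and q_id: "x \<in> span (range (case_prod bracket)) \<Longrightarrow> q x = x"
begin

definition derived :: "'a set" where "derived = span (range (case_prod bracket))"

sublocale br: Vector_Spaces.linear scale scale "bracket x" for x
  by (rule linear_right)

sublocale bl: Vector_Spaces.linear scale scale "\<lambda>x. bracket x y" for y
  by (rule linear_left)

sublocale q: Vector_Spaces.linear scale scale q
  by (rule q_linear)

lemma bracket_derived: "bracket x y \<in> derived"
  unfolding derived_def by (rule span_base) (metis case_prod_conv rangeI)

lemma q_in_derived: "q x \<in> derived"
  using q_derived by (simp add: derived_def)

lemma add_derived: "a \<in> derived \<Longrightarrow> b \<in> derived \<Longrightarrow> a + b \<in> derived"
  by (simp add: derived_def span_add)

lemma antisym: "bracket x y = - bracket y x"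
  using alternating[of "x + y"]
  by (simp add: br.add bl.add alternating[of x] alternating[of y] eq_neg_iff_add_eq_0 add.commute)

lemma derived_abelian:
  assumes "m \<in> derived" "m' \<in> derived"
  shows "bracket m m' = 0"
proof -
  have *: "bracket (bracket a b) m' = 0" for a b
    using assms(2) unfolding derived_def
    by (induction rule: span_induct_alt) (auto simp: br.add br.scale metabelian br.zero)
  show ?thesis
    using assms(1) unfolding derived_def
    by (induction rule: span_induct_alt) (auto simp: bl.add bl.scale * bl.zero)
qed

text \<open>By the Jacobi identity the two sides differ by \<open>[[x,y], m]\<close>, a bracket of two elements of the
  abelian derived algebra. Hence the derived algebra is a module over a symmetric algebra.\<close>
lemma derived_act_commute:
  assumes "m \<in> derived"
  shows "bracket x (bracket y m) = bracket y (bracket x m)"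
proof -
  have "bracket m (bracket x y) = 0"
    using assms bracket_derived by (rule derived_abelian)
  with jacobi[of x y m] show ?thesis
    by (simp add: antisym[of m x] br.neg)
qed

definition ad_word :: "'a list \<Rightarrow> 'a \<Rightarrow> 'a" where
  "ad_word w m = foldr bracket w m"

lemma ad_word_simps [simp]:
  "ad_word [] m = m" "ad_word (x # w) m = bracket x (ad_word w m)"
  by (simp_all add: ad_word_def)

lemma ad_word_derived: "m \<in> derived \<Longrightarrow> ad_word w m \<in> derived"
  by (cases w) (auto intro: bracket_derived)

lemma ad_word_add: "ad_word w (m + m') = ad_word w m + ad_word w m'"
  by (induction w) (auto simp: br.add)

lemma ad_word_diff: "ad_word w (m - m') = ad_word w m - ad_word w m'"
  by (induction w) (auto simp: br.diff)

lemma ad_word_scale: "ad_word w (scale c m) = scale c (ad_word w m)"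
  by (induction w) (auto simp: br.scale)

lemma ad_word_bracket:
  "m \<in> derived \<Longrightarrow> ad_word w (bracket x m) = bracket x (ad_word w m)"
  by (induction w) (auto simp: derived_act_commute ad_word_derived)

text \<open>Letting words act on \<open>m\<close> is the canonical map of the derived algebra into the coinduced
  module, because letters act on it by commuting operators that depend linearly on the letter.\<close>
lemma ad_word_sym_multilinear:
  assumes m: "m \<in> derived"
  shows "(\<lambda>w. ad_word w m) \<in> sym_multilinear"
proof -
  have "ad_word (u @ x # y # w) m = ad_word (u @ y # x # w) m"
    "ad_word (u @ (x + y) # w) m = ad_word (u @ x # w) m + ad_word (u @ y # w) m"
    "ad_word (u @ scale c x # w) m = scale c (ad_word (u @ x # w) m)" for u w x y c
    by (induction u) (auto simp: derived_act_commute[OF ad_word_derived[OF m], of x y]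
        br.add br.scale bl.add bl.scale)
  then show ?thesis by (simp add: sym_multilinear_def)
qed

text \<open>The recursion unfolds to \<open>ad w (q y)\<close> plus the sum over the positions \<open>i\<close> of \<open>w\<close> of \<open>[w_i, y]\<close>
  acted on by the remaining letters: in the second equation the new letter \<open>x\<close> is either the one that
  is bracketed with \<open>y\<close>, or it acts on the sum for \<open>w\<close>.\<close>
fun homotopy :: "'a \<Rightarrow> 'a list \<Rightarrow> 'a" where
  "homotopy y [] = q y"
| "homotopy y (x # w) = ad_word w (bracket x y) + bracket x (homotopy y w)"

lemma homotopy_derived: "homotopy y w \<in> derived"
  by (induction w) (auto intro!: add_derived bracket_derived ad_word_derived q_in_derived)

lemma homotopy_add: "homotopy (y + z) w = homotopy y w + homotopy z w"
  by (induction w) (auto simp: q.add br.add ad_word_add)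

lemma homotopy_scale: "homotopy (scale c y) w = scale c (homotopy y w)"
  by (induction w) (auto simp: q.scale br.scale ad_word_scale scale_right_distrib)

lemma homotopy_sym_multilinear: "homotopy z \<in> sym_multilinear"
proof -
  note W = ad_word_sym_multilinear[OF bracket_derived, unfolded sym_multilinear_def mem_Collect_eq]
  have "homotopy z (u @ x # y # w) = homotopy z (u @ y # x # w)" for u w x y
  proof (induction u)
    case Nil
    show ?case
      by (simp add: br.add derived_act_commute[OF homotopy_derived, of x y])
  next
    case (Cons v u)
    then show ?case using W by simp
  qed
  moreover have "homotopy z (u @ (x + y) # w) = homotopy z (u @ x # w) + homotopy z (u @ y # w)"
    for u w x y
  proof (induction u)
    case Nil
    show ?case by (simp add: bl.add ad_word_add)
  next
    case (Cons v u)
    then show ?case using W by (simp add: br.add)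
  qed
  moreover have "homotopy z (u @ scale c x # w) = scale c (homotopy z (u @ x # w))" for u w x c
  proof (induction u)
    case Nil
    show ?case by (simp add: bl.scale ad_word_scale scale_right_distrib)
  next
    case (Cons v u)
    then show ?case using W by (simp add: br.scale scale_right_distrib)
  qed
  ultimately show ?thesis by (simp add: sym_multilinear_def)
qed

lemma scale_two: "scale 2 m = m + m"
  using scale_left_distrib[of 1 1 m] by simp

text \<open>For \<open>m\<close> in the derived algebra each of the \<open>length w\<close> summands equals \<open>ad w m\<close>, and so does
  the initial term \<open>ad w (q m)\<close>. The division by \<open>length w + 1\<close> below thus turns the homotopy into
  the canonical map, which needs characteristic \<open>0\<close>.\<close>
lemma homotopy_on_derived:
  assumes m: "m \<in> derived"
  shows "homotopy m w = scale (of_nat (Suc (length w))) (ad_word w m)"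
proof (induction w)
  case Nil
  then show ?case using m by (simp add: q_id derived_def)
next
  case (Cons x w)
  then show ?case
    by (simp add: ad_word_bracket[OF m] br.add br.scale scale_left_distrib scale_two)
qed

definition proj :: "'a \<Rightarrow> 'a" where "proj x = x - q x"

lemma bracket_proj: "m \<in> derived \<Longrightarrow> bracket (proj x) m = bracket x m"
  by (simp add: proj_def bl.diff derived_abelian q_in_derived)

text \<open>Each letter \<open>z\<close> of \<open>w\<close> contributes one copy of \<open>ad w [x,y]\<close>, because
  \<open>[x,[z,y]] - [y,[z,x]] = [z,[x,y]]\<close> by the Jacobi identity.\<close>
lemma homotopy_tail_cocycle:
  "bracket x (homotopy y w) - bracket y (homotopy x w)
   = scale (of_nat (length w)) (ad_word w (bracket x y))
     + ad_word w (bracket x (q y) - bracket y (q x))"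
proof (induction w)
  case Nil
  show ?case by simp
next
  case (Cons z w)
  let ?m = "bracket x y"
  have J: "bracket x (bracket z y) - bracket y (bracket z x) = bracket z ?m"
    using jacobi[of x y z]
    by (simp add: antisym[of z y] antisym[of z ?m] antisym[of z x] br.neg
        algebra_simps eq_neg_iff_add_eq_0)
  have "bracket x (homotopy y (z # w)) - bracket y (homotopy x (z # w))
      = ad_word w (bracket x (bracket z y)) - ad_word w (bracket y (bracket z x))
        + bracket z (bracket x (homotopy y w) - bracket y (homotopy x w))"
    by (simp add: br.add br.diff ad_word_bracket bracket_derived
        derived_act_commute[OF homotopy_derived, of z])
  also have "ad_word w (bracket x (bracket z y)) - ad_word w (bracket y (bracket z x))
      = bracket z (ad_word w ?m)"
    unfolding ad_word_diff [symmetric] J by (rule ad_word_bracket [OF bracket_derived])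
  also note Cons.IH
  finally show ?case
    by (simp add: br.add br.scale scale_left_distrib)
qed

text \<open>Besides the \<open>length w\<close> copies of \<open>ad w [x,y]\<close> coming from the letters of \<open>w\<close>, the new front
  letters and the initial terms contribute
  \<open>[p x, y] - [p y, x] + [x, q y] - [y, q x]\<close> with \<open>p = id - q\<close>. This is \<open>2 [x,y]\<close>: the mixed terms
  \<open>[q x, y]\<close> and \<open>[x, q y]\<close> cancel.\<close>
lemma homotopy_cocycle:
  "homotopy y (proj x # w) - homotopy x (proj y # w)
   = scale (of_nat (length w + 2)) (ad_word w (bracket x y))"
proof -
  have "homotopy y (proj x # w) - homotopy x (proj y # w)
      = ad_word w (bracket (proj x) y) - ad_word w (bracket (proj y) x)
        + (bracket x (homotopy y w) - bracket y (homotopy x w))"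
    by (simp add: bracket_proj homotopy_derived)
  also have "\<dots> = scale (of_nat (length w)) (ad_word w (bracket x y))
      + ad_word w (bracket (proj x) y - bracket (proj y) x
        + (bracket x (q y) - bracket y (q x)))"
    unfolding homotopy_tail_cocycle by (simp add: ad_word_add ad_word_diff)
  also have "bracket (proj x) y - bracket (proj y) x + (bracket x (q y) - bracket y (q x))
      = bracket x y + bracket x y"
    by (simp add: proj_def bl.diff antisym[of y x] antisym[of "q x" y] antisym[of "q y" x])
  finally show ?thesis
    by (simp add: ad_word_add scale_left_distrib scale_two)
qed

definition embed :: "'a \<Rightarrow> 'a envelope" where
  "embed x = (proj x, \<lambda>w. scale (inverse (of_nat (Suc (length w)))) (homotopy x w))"

lemma embed_linear: "Vector_Spaces.linear scale scale_env embed"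
  by (auto simp: Vector_Spaces.linear_iff vector_space_axioms vector_space_scale_env
      embed_def proj_def scale_env_def scale_fun_def fun_eq_iff q.add q.scale homotopy_add
      homotopy_scale scale_right_distrib scale_right_diff_distrib mult.commute)

lemma embed_inj: "inj embed"
proof (rule inj_on_inverseI)
  show "fst (embed x) + snd (embed x) [] = x" for x
    by (simp add: embed_def proj_def)
qed

lemma embed_sym_multilinear: "snd (embed x) \<in> sym_multilinear"
  using homotopy_sym_multilinear[of x]
  by (auto simp: embed_def sym_multilinear_def scale_right_distrib mult.commute)

text \<open>The second components of both sides have at a word \<open>w\<close> of length \<open>n\<close> the value \<open>ad w [x,y]\<close>:
  on the left the normalisation \<open>1/(n+1)\<close> meets the factor \<open>n+1\<close> of \<open>homotopy_on_derived\<close>, while on the right the shift has lengthened the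
  words by one, so that \<open>1/(n+2)\<close> meets the factor \<open>n+2\<close> of \<open>homotopy_cocycle\<close>.\<close>
lemma embed_bracket:
  assumes P_id: "\<And>\<phi>. \<phi> \<in> sym_multilinear \<Longrightarrow> P \<phi> = \<phi>"
  shows "embed (bracket x y)
    = shift_mult P (embed x) (embed y) - shift_mult P (embed y) (embed x)"
proof -
  have D: "bracket x y \<in> derived" by (rule bracket_derived)
  have "proj (bracket x y) = 0"
    using D by (simp add: proj_def derived_def q_id)
  moreover have "scale (inverse (of_nat (Suc (length w)))) (homotopy (bracket x y) w)
      = scale (inverse (of_nat (length w + 2))) (homotopy y (proj x # w))
        - scale (inverse (of_nat (length w + 2))) (homotopy x (proj y # w))" for w
    unfolding scale_right_diff_distrib[symmetric] homotopy_cocycle homotopy_on_derived[OF D]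
    by (simp del: of_nat_Suc of_nat_add)
  ultimately show ?thesis
    by (simp add: shift_mult_def P_id[OF embed_sym_multilinear] prod_eq_iff fun_eq_iff)
       (simp add: embed_def)
qed

end

theorem corollary34:
  fixes \<delta> :: complex
    and scaleL :: "complex \<Rightarrow> 'a::ab_group_add \<Rightarrow> 'a"
    and bracket :: "'a \<Rightarrow> 'a \<Rightarrow> 'a"
  assumes "metabelian_lie_algebra scaleL bracket"
  shows "\<exists>(scaleN :: complex \<Rightarrow> 'a envelope \<Rightarrow> 'a envelope) mult \<iota>.
    delta_novikov_algebra \<delta> scaleN mult \<and>
    Vector_Spaces.linear scaleL scaleN \<iota> \<and> inj \<iota> \<and>
    (\<forall>a b. \<iota> (bracket a b) = mult (\<iota> a) (\<iota> b) - mult (\<iota> b) (\<iota> a))"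
proof -
  interpret L: metabelian_lie_algebra scaleL bracket by (rule assms)
  obtain q where q: "Vector_Spaces.linear scaleL scaleL q"
    "\<And>x. q x \<in> L.span (range (case_prod bracket))"
    "\<And>x. x \<in> L.span (range (case_prod bracket)) \<Longrightarrow> q x = x"
    by (rule linear_projection_exists[OF L.vector_space_axioms L.subspace_span]) blast
  interpret metabelian_split scaleL bracket q
    by (intro metabelian_split.intro metabelian_split_axioms.intro word_functions.intro
        L.metabelian_lie_algebra_axioms L.vector_space_axioms q)
  obtain P where P: "Vector_Spaces.linear scale_fun scale_fun P"
    "\<And>\<phi>. P \<phi> \<in> sym_multilinear" "\<And>\<phi>. \<phi> \<in> sym_multilinear \<Longrightarrow> P \<phi> = \<phi>"
    by (rule linear_projection_exists[OF vector_space_scale_fun subspace_sym_multilinear]) blast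
  show ?thesis
    using delta_novikov_shift_mult[OF P] embed_linear embed_inj embed_bracket[of P, OF P(3)]
    by blast
qed

end
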